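(* The generating function of the triple statistic $(\mathsf{des},\mathsf{iar},\mathsf{comp})$ over the sets $\mathfrak{S}_n(312)$ is given by $$\tilde{\mathfrak{S}}(312)^{\mathsf{des},\mathsf{iar},\mathsf{comp}}(t,r,p)=\frac{1-(r+p+tN)z+(rp+(r+p-1)tN)z^2}{(1-rpz)(1-rz-tNz)(1-pz-tNz)},$$ where $$N=N(t;z)=\frac{1+(t-1)z-\sqrt{1-2(t+1)z+(t-1)^2z^2}}{2tz}.$$
   Context: $\mathfrak{S}_n$ is the set of permutations $\pi=\pi(1)\cdots\pi(n)$ of $[n]=\{1,\dots,n\}$. A permutation $\pi\in\mathfrak{S}_n$ contains the pattern $\sigma\in\mathfrak{S}_k$ if there are $j_1<\cdots<j_k$ such that $\pi(j_a)<\pi(j_b)$ if and only if $\sigma(a)<\sigma(b)$ for all $1\le a<b\le k$; otherwise it avoids $\sigma$. For a set $P$ of patterns, $\mathfrak{S}_n(P)$ is the set of $\pi\in\mathfrak{S}_n$ avoiding every pattern in $P$. For $\pi\in\mathfrak{S}_n$: $\mathrm{DES}(\pi)=\{i\in[n-1]:\pi(i)>\pi(i+1)\}$, $\mathsf{des}(\pi)=|\mathrm{DES}(\pi)|$, $\mathsf{iar}(\pi)=\min(\mathrm{DES}(\pi)\cup\{n\})$, $\mathsf{comp}(\pi)=|\{i\in[n]:\pi(j)\le i\text{ for all }j\le i\}|$. Define the formal power series in $z$ $$\mathfrak{S}(P)^{\mathsf{des},\mathsf{iar},\mathsf{comp}}(t,r,p;z)=\sum_{n\ge0}z^n\sum_{\pi\in\mathfrak{S}_n(P)}t^{\mathsf{des}(\pi)}r^{\mathsf{iar}(\pi)}p^{\mathsf{comp}(\pi)},$$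 where the empty permutation ($n=0$) contributes $1$, and $\tilde{\mathfrak{S}}(P)^{\mathsf{des},\mathsf{iar},\mathsf{comp}}(t,r,p)=\big(\mathfrak{S}(P)^{\mathsf{des},\mathsf{iar},\mathsf{comp}}(t,r,p;z)-1\big)/(rpz)$. Square roots denote the formal power series with constant term $1$; thus $N=\sum_{n\ge0}z^n\sum_{\pi\in\mathfrak{S}_n(312)}t^{\mathsf{des}(\pi)}$ is the generating function of the Narayana polynomials. *)

theory Defs
  imports
    "HOL-Combinatorics.Multiset_Permutations"
    "HOL-Computational_Algebra.Formal_Power_Series"
    "HOL-Computational_Algebra.Polynomial_Factorial"
begin

text \<open>A permutation of \<open>[n]\<close> is the list \<open>\<pi>(1), \<dots>, \<pi>(n)\<close>, so that \<open>n\<close> is its length.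
  List indexing starts at 0; \<open>entry\<close> shifts it, so that \<open>entry \<pi> i\<close> is \<open>\<pi>(i)\<close> for
  \<open>1 \<le> i \<le> n\<close>.\<close>

abbreviation entry :: "nat list \<Rightarrow> nat \<Rightarrow> nat" where
  "entry \<pi> i \<equiv> \<pi> ! (i - 1)"

definition contains_pattern :: "nat list \<Rightarrow> nat list \<Rightarrow> bool" where
  "contains_pattern \<pi> \<sigma> \<longleftrightarrow>
     (\<exists>j :: nat \<Rightarrow> nat.
        strict_mono_on {1..length \<sigma>} j \<and>
        j ` {1..length \<sigma>} \<subseteq> {1..length \<pi>} \<and>
        (\<forall>a b. 1 \<le> a \<and> a < b \<and> b \<le> length \<sigma> \<longrightarrow>
           (entry \<pi> (j a) < entry \<pi> (j b) \<longleftrightarrow> entry \<sigma> a < entry \<sigma> b)))"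

definition avoiders :: "nat list set \<Rightarrow> nat \<Rightarrow> nat list set" where
  "avoiders P n = {\<pi> \<in> permutations_of_set {1..n}. \<forall>\<sigma>\<in>P. \<not> contains_pattern \<pi> \<sigma>}"

definition DES :: "nat list \<Rightarrow> nat set" where
  "DES \<pi> = {i \<in> {1..<length \<pi>}. entry \<pi> i > entry \<pi> (i + 1)}"

definition des :: "nat list \<Rightarrow> nat" where
  "des \<pi> = card (DES \<pi>)"

definition iar :: "nat list \<Rightarrow> nat" where
  "iar \<pi> = Min (DES \<pi> \<union> {length \<pi>})"

definition ncomp :: "nat list \<Rightarrow> nat" where
  "ncomp \<pi> = card {i \<in> {1..length \<pi>}. \<forall>j\<in>{1..i}. entry \<pi> j \<le> i}"

text \<open>The series in \<open>z\<close> are taken over the field \<open>\<rat>(t, r, p)\<close>, in which \<open>\<rat>[t, r, p]\<close>, here the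
  iterated polynomial ring \<open>\<rat>[p][r][t]\<close>, embeds. Division by \<open>r p\<close> and \<open>2 t\<close> thus makes sense,
  and the remaining factor \<open>z\<close> in those denominators is cancelled exactly by division of
  formal power series.\<close>

type_synonym coeff_field = "rat poly poly poly fract"

definition var_t :: coeff_field where
  "var_t = to_fract [:0, 1:]"

definition var_r :: coeff_field where
  "var_r = to_fract [:[:0, 1:]:]"

definition var_p :: coeff_field where
  "var_p = to_fract [:[:[:0, 1:]:]:]"

definition gf :: "nat list set \<Rightarrow> 'a \<Rightarrow> 'a \<Rightarrow> 'a \<Rightarrow> 'a :: comm_semiring_1 fps" where
  "gf P t r p =
     Abs_fps (\<lambda>n. \<Sum>\<pi>\<in>avoiders P n. t ^ des \<pi> * r ^ iar \<pi> * p ^ ncomp \<pi>)"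

definition gf_tilde :: "nat list set \<Rightarrow> 'a \<Rightarrow> 'a \<Rightarrow> 'a \<Rightarrow> 'a :: field fps" where
  "gf_tilde P t r p = (gf P t r p - 1) / (fps_const r * fps_const p * fps_X)"

text \<open>The first argument of \<open>fps_radical\<close> chooses the root of the constant term.\<close>

definition fps_sqrt :: "'a :: field_char_0 fps \<Rightarrow> 'a fps" where
  "fps_sqrt a = fps_radical (\<lambda>_ _. 1) 2 a"

lemma fps_sqrt_nth_0: "fps_nth (fps_sqrt a) 0 = 1"
  by (simp add: fps_sqrt_def)

lemma fps_sqrt_power2:
  assumes "fps_nth a 0 = 1"
  shows "fps_sqrt a ^ 2 = a"
  using power_radical[of a "\<lambda>_ _. 1" 1] assms
  by (simp add: fps_sqrt_def numeral_2_eq_2)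

definition narayana_gf :: "'a :: field_char_0 \<Rightarrow> 'a fps" where
  "narayana_gf t =
     (let t = fps_const t; z = fps_X in
      (1 + (t - 1) * z - fps_sqrt (1 - 2 * (t + 1) * z + (t - 1)\<^sup>2 * z\<^sup>2)) / (2 * t * z))"

end

theory Submission
  imports Defs
begin

text \<open>
  Write \<open>F(r, p)\<close> for the generating function of \<open>(des, iar, comp)\<close> over the 312-avoiding
  permutations, with \<open>t\<close> and \<open>z\<close> kept implicit. The proof cuts a nonempty 312-avoider at its
  entry 1. Every entry before the 1 must be smaller than every entry after it, since otherwise the
  two of them form a 312 with the 1 as the smallest entry. Hence the avoider is
  \<open>A\<^sup>+ 1 B\<^sup>+\<close> with two smaller 312-avoiders \<open>A\<close> and \<open>B\<close> whose entries are shifted up, and \<open>A\<close>, \<open>B\<close>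
  can be chosen freely (\<open>avoiders_312_Suc\<close>).

  All three statistics can be read off this decomposition. The block \<open>A\<^sup>+ 1\<close> is exactly one
  component, so \<open>comp\<close> is one more than that of \<open>B\<close>. If \<open>A\<close> is empty, the leading 1 prolongs the
  initial ascending run of \<open>B\<close>. If \<open>A\<close> is nonempty, the 1 creates a descent, and this descent ends
  the initial run within \<open>A\<close>. Summation yields (\<open>gf_312_eq\<close>)
  \<open>F(r, p) = 1 + z p (r F(r, p) + t (F(r, 1) - 1) F(1, p))\<close>.

  Now specialise. For \<open>r = p = 1\<close> this is the quadratic equation of \<open>N\<close>, so \<open>N = F(1, 1)\<close>
  (\<open>narayana_gf_eq_gf_312\<close>). For \<open>p = 1\<close> and for \<open>r = 1\<close> it is a linear equation over
  \<open>N\<close> for \<open>F(r, 1)\<close> and \<open>F(1, p)\<close>, respectively, and these two series then determine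
  \<open>F(r, p)\<close>, again linearly.
\<close>

section \<open>Decomposition of 312-avoiders at the entry 1\<close>

text \<open>A constant for the pattern keeps simplification from rewriting its entry \<open>1\<close> to \<open>Suc 0\<close>.\<close>

definition pat312 :: "nat list" where
  "pat312 = [3, 1, 2]"

text \<open>That \<open>xs ! i\<close> exceeds \<open>xs ! j\<close> follows from the other two inequalities.\<close>

definition contains_312 :: "nat list \<Rightarrow> bool" where
  "contains_312 xs \<longleftrightarrow>
     (\<exists>i j k. i < j \<and> j < k \<and> k < length xs \<and> xs ! j < xs ! k \<and> xs ! k \<le> xs ! i)"

lemma contains_312I:
  "i < j \<Longrightarrow> j < k \<Longrightarrow> k < length xs \<Longrightarrow> xs ! j < xs ! k \<Longrightarrow> xs ! k \<le> xs ! i \<Longrightarrow> contains_312 xs"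
  unfolding contains_312_def by blast

lemma contains_pattern_312_iff: "contains_pattern xs pat312 \<longleftrightarrow> contains_312 xs"
proof
  have len: "length pat312 = 3" by (simp add: pat312_def)
  assume "contains_pattern xs pat312"
  then obtain j where j: "strict_mono_on {1..3} j" "j ` {1..3} \<subseteq> {1..length xs}"
    "\<forall>a b. 1 \<le> a \<and> a < b \<and> b \<le> 3 \<longrightarrow>
       (entry xs (j a) < entry xs (j b) \<longleftrightarrow> entry pat312 a < entry pat312 b)"
    unfolding contains_pattern_def len by blast
  have "j 1 < j 2" "j 2 < j 3"
    using j(1) by (auto simp: strict_mono_on_def)
  moreover have "1 \<le> j 1" "j 3 \<le> length xs"
    using j(2) by (auto simp: image_subset_iff)
  moreover have "entry xs (j 2) < entry xs (j 3)" "entry xs (j 3) \<le> entry xs (j 1)"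
    using j(3)[rule_format, of 2 3] j(3)[rule_format, of 1 3]
    by (auto simp: pat312_def numeral_3_eq_3 numeral_2_eq_2)
  ultimately show "contains_312 xs"
    by (intro contains_312I[of "j 1 - 1" "j 2 - 1" "j 3 - 1"]) auto
next
  have len: "length pat312 = 3" by (simp add: pat312_def)
  assume "contains_312 xs"
  then obtain i j k where ijk: "i < j" "j < k" "k < length xs" "xs ! j < xs ! k" "xs ! k \<le> xs ! i"
    unfolding contains_312_def by blast
  define f where "f a = (if a = 1 then Suc i else if a = 2 then Suc j else Suc k)" for a :: nat
  have "strict_mono_on {1..3} f"
    using ijk by (auto simp: strict_mono_on_def f_def)
  moreover have "f ` {1..3} \<subseteq> {1..length xs}"
    using ijk by (auto simp: f_def)
  moreover have "entry xs (f a) < entry xs (f b) \<longleftrightarrow> entry pat312 a < entry pat312 b"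
    if "1 \<le> a" "a < b" "b \<le> 3" for a b
  proof -
    from that consider "a = 1" "b = 2" | "a = 1" "b = 3" | "a = 2" "b = 3" by linarith
    then show ?thesis using ijk by cases (auto simp: f_def pat312_def numeral_3_eq_3 numeral_2_eq_2)
  qed
  ultimately show "contains_pattern xs pat312"
    unfolding contains_pattern_def len by (intro exI[of _ f]) auto
qed

lemma avoiders_312_iff:
  "xs \<in> avoiders {pat312} n \<longleftrightarrow> set xs = {1..n} \<and> distinct xs \<and> \<not> contains_312 xs"
  by (auto simp: avoiders_def permutations_of_set_def contains_pattern_312_iff)

lemma length_avoider_312: "xs \<in> avoiders {pat312} n \<Longrightarrow> length xs = n"
  using distinct_card[of xs] by (auto simp: avoiders_312_iff)

lemma finite_avoiders: "finite (avoiders P n)"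
  by (auto simp: avoiders_def)

lemma avoiders_312_0: "avoiders {pat312} 0 = {[]}"
  by (auto simp: avoiders_312_iff contains_312_def)

definition glue :: "nat list \<Rightarrow> nat list \<Rightarrow> nat list" where
  "glue A B = map Suc A @ 1 # map (\<lambda>x. x + Suc (length A)) B"

lemma length_glue [simp]: "length (glue A B) = Suc (length A + length B)"
  by (simp add: glue_def)

lemma glue_nth_left: "i < length A \<Longrightarrow> glue A B ! i = Suc (A ! i)"
  by (simp add: glue_def nth_append)

lemma glue_nth_mid: "glue A B ! length A = 1"
  by (simp add: glue_def nth_append)

lemma glue_nth_right: "i < length B \<Longrightarrow> glue A B ! (Suc (length A) + i) = B ! i + Suc (length A)"
  by (simp add: glue_def nth_append)

lemma glue_nth_right': "length A < i \<Longrightarrow> i \<le> length A + length B \<Longrightarrow>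
  glue A B ! i = B ! (i - Suc (length A)) + Suc (length A)"
  using glue_nth_right[of "i - Suc (length A)" B A] by simp

text \<open>The positions of an occurrence of 312 lie all in \<open>A\<close> or all in \<open>B\<close>: the last one cannot be
  that of the 1, and if it lies in \<open>B\<close>, then so does the first one, because its entry is at
  least as large.\<close>

lemma contains_312_glue_iff:
  assumes A: "set A = {1..length A}" and B: "set B = {1..length B}"
  shows "contains_312 (glue A B) \<longleftrightarrow> contains_312 A \<or> contains_312 B"
proof
  assume "contains_312 (glue A B)"
  then obtain i j k where ijk: "i < j" "j < k" "k < length (glue A B)"
      "glue A B ! j < glue A B ! k" "glue A B ! k \<le> glue A B ! i"
    unfolding contains_312_def by blast
  consider "k < length A" | "k = length A" | "k > length A" by linarith
  then show "contains_312 A \<or> contains_312 B"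
  proof cases
    case 1
    then have "contains_312 A"
      using ijk by (intro contains_312I[of i j k]) (auto simp: glue_nth_left)
    then show ?thesis ..
  next
    case 2
    then show ?thesis using ijk by (simp add: glue_nth_left glue_nth_mid)
  next
    case 3
    have "B ! (k - Suc (length A)) \<in> set B" using 3 ijk by (intro nth_mem) auto
    then have big: "glue A B ! k > Suc (length A)"
      using 3 ijk B by (simp add: glue_nth_right')
    have small: "glue A B ! l \<le> Suc (length A)" if "l \<le> length A" for l
      using that A nth_mem[of l A]
      by (cases "l = length A") (auto simp: glue_nth_mid glue_nth_left)
    have i: "i > length A" using small[of i] big ijk(5) by linarith
    have "contains_312 B"
      using ijk i by (intro contains_312I[of "i - Suc (length A)" "j - Suc (length A)" "k - Suc (length A)"])
        (auto simp: glue_nth_right')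
    then show ?thesis ..
  qed
next
  assume "contains_312 A \<or> contains_312 B"
  then show "contains_312 (glue A B)"
  proof
    assume "contains_312 A"
    then obtain i j k where ijk: "i < j" "j < k" "k < length A" "A ! j < A ! k" "A ! k \<le> A ! i"
      unfolding contains_312_def by blast
    then show ?thesis by (intro contains_312I[of i j k]) (auto simp: glue_nth_left)
  next
    assume "contains_312 B"
    then obtain i j k where ijk: "i < j" "j < k" "k < length B" "B ! j < B ! k" "B ! k \<le> B ! i"
      unfolding contains_312_def by blast
    then show ?thesis
      by (intro contains_312I[of "Suc (length A) + i" "Suc (length A) + j" "Suc (length A) + k"])
        (simp_all add: glue_nth_right')
  qed
qed

lemma glue_in_avoiders:
  assumes "A \<in> avoiders {pat312} k" "B \<in> avoiders {pat312} l"
  shows "glue A B \<in> avoiders {pat312} (Suc (k + l))"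
proof -
  have len: "length A = k" "length B = l" using assms by (simp_all add: length_avoider_312)
  have sets: "set A = {1..k}" "set B = {1..l}" using assms by (auto simp: avoiders_312_iff)
  have "(\<lambda>x. x + Suc k) ` {1..l} = {1 + Suc k..l + Suc k}"
    by (rule image_add_atLeastAtMost')
  then have "set (glue A B) = {1..Suc (k + l)}"
    using sets len by (auto simp: glue_def image_Suc_atLeastAtMost)
  moreover have "distinct (glue A B)"
    using assms len by (auto simp: glue_def avoiders_312_iff distinct_map inj_on_def)
  ultimately show ?thesis
    using contains_312_glue_iff[of A B] assms len by (auto simp: avoiders_312_iff)
qed

lemma glue_inject:
  assumes "length A = length A'"
  shows "glue A B = glue A' B' \<longleftrightarrow> A = A' \<and> B = B'"
proof -
  have "inj (\<lambda>x. x + Suc (length A'))" by (simp add: inj_on_def)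
  then show ?thesis using assms by (auto simp: glue_def inj_map_eq_map)
qed

lemma down_closed_eq_atLeastLessThan:
  fixes S :: "nat set"
  assumes "S \<subseteq> {m..n}" and down: "\<And>x y. x \<in> S \<Longrightarrow> y \<in> {m..n} - S \<Longrightarrow> x < y"
  shows "S = {m..<m + card S}"
proof (cases "S = {}")
  case False
  have fin: "finite S" using assms(1) finite_subset by blast
  have eq: "S = {m..<Suc (Max S)}"
  proof (intro equalityI subsetI)
    fix x assume "x \<in> S"
    then show "x \<in> {m..<Suc (Max S)}"
      using assms(1) fin by (auto simp: less_Suc_eq_le)
  next
    fix x assume x: "x \<in> {m..<Suc (Max S)}"
    have M: "Max S \<in> S" using fin False by simp
    show "x \<in> S"
    proof (rule ccontr)
      assume "x \<notin> S"
      moreover have "x \<in> {m..n}" using x M assms(1) by auto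
      ultimately have "Max S < x" using down[OF M, of x] by simp
      then show False using x by simp
    qed
  qed
  have "Max S \<in> S" using fin False by simp
  then have "m \<le> Max S" using assms(1) by auto
  moreover have "card S = Suc (Max S) - m" using arg_cong[OF eq, of card] by simp
  ultimately have "m + card S = Suc (Max S)" by simp
  then show ?thesis using eq by (simp only:)
qed simp

text \<open>An entry \<open>a\<close> before the 1 and a smaller entry \<open>b\<close> after it would form the occurrence
  \<open>a 1 b\<close> of 312. So the entries before the 1 are the smallest ones of \<open>{2..Suc n}\<close>. Both parts
  thus occupy an interval of values, and shifting these down yields two permutations.\<close>

lemma avoider_312_decompose:
  assumes "xs \<in> avoiders {pat312} (Suc n)"
  obtains A B k where "k \<le> n" "A \<in> avoiders {pat312} k" "B \<in> avoiders {pat312} (n - k)"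
    "xs = glue A B"
proof -
  have set: "set xs = {1..Suc n}" and dist: "distinct xs" and av: "\<not> contains_312 xs"
    using assms by (auto simp: avoiders_312_iff)
  have "1 \<in> set xs" using set by simp
  then obtain A' B' where xs: "xs = A' @ 1 # B'" by (meson split_list)
  define k where "k = length A'"
  have "set A' \<union> set B' = set xs - {1}" and disj: "set A' \<inter> set B' = {}"
    using dist xs by auto
  moreover have "set xs - {1} = {2..Suc n}" using set by auto
  ultimately have un: "set A' \<union> set B' = {2..Suc n}" by simp
  have less: "a < b" if ab: "a \<in> set A'" "b \<in> set B'" for a b
  proof (rule ccontr)
    assume "\<not> a < b"
    obtain i where i: "i < length A'" "A' ! i = a" using ab(1) by (auto simp: in_set_conv_nth)
    obtain j where j: "j < length B'" "B' ! j = b" using ab(2) by (auto simp: in_set_conv_nth)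
    have "b \<in> {2..Suc n}" using un ab by auto
    then have "contains_312 xs"
      using i j \<open>\<not> a < b\<close>
      by (intro contains_312I[of i "length A'" "Suc (length A' + j)"]) (auto simp: xs nth_append)
    then show False using av by simp
  qed
  have cardA: "card (set A') = k" using dist xs by (simp add: k_def distinct_card)
  have "set A' = {2..<2 + card (set A')}"
  proof (rule down_closed_eq_atLeastLessThan)
    show "set A' \<subseteq> {2..Suc n}" using un by blast
    show "x < y" if "x \<in> set A'" "y \<in> {2..Suc n} - set A'" for x y
      using that un less by blast
  qed
  then have setA: "set A' = {2..<2 + k}" by (simp only: cardA)
  have setB: "set B' = {2 + k..<2 + n}"
  proof -
    have "set B' = {2..Suc n} - {2..<2 + k}" using un disj setA by blast
    then show ?thesis by auto
  qed
  have "length xs = Suc n" using assms by (rule length_avoider_312)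
  then have lenB: "length B' = n - k" and "k \<le> n" by (auto simp: xs k_def)
  define A where "A = map (\<lambda>x. x - 1) A'"
  define B where "B = map (\<lambda>x. x - Suc k) B'"
  have lenA: "length A = k" by (simp add: A_def k_def)
  have "map Suc A = map id A'"
    unfolding A_def map_map using setA by (intro map_cong) auto
  moreover have "map (\<lambda>x. x + Suc k) B = map id B'"
    unfolding B_def map_map using setB by (intro map_cong) auto
  ultimately have xs': "xs = glue A B"
    by (simp add: glue_def xs lenA)
  have A'S: "set A' = Suc ` {1..k}" unfolding setA by (auto simp: image_Suc_atLeastAtMost)
  then have sA: "set A = {1..k}"
    unfolding A_def set_map A'S image_image by simp
  have "{2 + k..<2 + n} = (\<lambda>x. x + Suc k) ` {1..n - k}"
    unfolding image_add_atLeastAtMost' using \<open>k \<le> n\<close> by auto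
  then have sB: "set B = {1..n - k}"
    by (simp add: B_def image_image setB)
  have dA: "distinct A" and dB: "distinct B"
    using sA sB lenA lenB by (auto intro!: card_distinct simp: B_def)
  have "\<not> contains_312 A \<and> \<not> contains_312 B"
    using contains_312_glue_iff[of A B] av xs' sA sB lenA lenB by (simp add: B_def)
  then show ?thesis
    using that[of k A B] \<open>k \<le> n\<close> xs' sA sB dA dB by (auto simp: avoiders_312_iff)
qed

lemma avoiders_312_Suc:
  "bij_betw (\<lambda>(k, A, B). glue A B)
     (SIGMA k:{..n}. avoiders {pat312} k \<times> avoiders {pat312} (n - k))
     (avoiders {pat312} (Suc n))"
proof (rule bij_betwI')
  fix x y
  assume "x \<in> (SIGMA k:{..n}. avoiders {pat312} k \<times> avoiders {pat312} (n - k))"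
    and "y \<in> (SIGMA k:{..n}. avoiders {pat312} k \<times> avoiders {pat312} (n - k))"
  then obtain k A B k' A' B' where xy: "x = (k, A, B)" "y = (k', A', B')"
    and av: "A \<in> avoiders {pat312} k" "A' \<in> avoiders {pat312} k'"
    by blast
  have len: "length A = k" "length A' = k'" using av by (simp_all add: length_avoider_312)
  \<comment> \<open>The length of \<open>A\<close> is visible in the glued list as the position of its only entry 1.\<close>
  have "k = k'" if eq: "glue A B = glue A' B'"
  proof -
    have pos: "takeWhile (\<lambda>x. x \<noteq> 1) (glue C D) = map Suc C" if "C \<in> avoiders {pat312} m" for C D m
    proof -
      have "\<forall>x\<in>set (map Suc C). x \<noteq> 1" using that by (auto simp: avoiders_312_iff)
      then show ?thesis by (simp add: glue_def takeWhile_append)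
    qed
    show ?thesis using arg_cong[OF eq, of "\<lambda>xs. length (takeWhile (\<lambda>x. x \<noteq> 1) xs)"] len
      unfolding pos[OF av(1)] pos[OF av(2)] by simp
  qed
  then show "((case x of (k, A, B) \<Rightarrow> glue A B) = (case y of (k, A, B) \<Rightarrow> glue A B)) = (x = y)"
    using glue_inject[of A A' B B'] len by (auto simp: xy)
next
  fix x assume "x \<in> (SIGMA k:{..n}. avoiders {pat312} k \<times> avoiders {pat312} (n - k))"
  then obtain k A B where "x = (k, A, B)" "k \<le> n" "A \<in> avoiders {pat312} k"
      "B \<in> avoiders {pat312} (n - k)" by blast
  then show "(case x of (k, A, B) \<Rightarrow> glue A B) \<in> avoiders {pat312} (Suc n)"
    using glue_in_avoiders[of A k B "n - k"] by simp
next
  fix y assume "y \<in> avoiders {pat312} (Suc n)"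
  then obtain A B k where "k \<le> n" "A \<in> avoiders {pat312} k" "B \<in> avoiders {pat312} (n - k)"
    "y = glue A B" by (rule avoider_312_decompose)
  then show "\<exists>x\<in>SIGMA k:{..n}. avoiders {pat312} k \<times> avoiders {pat312} (n - k).
      y = (case x of (k, A, B) \<Rightarrow> glue A B)"
    by (intro bexI[of _ "(k, A, B)"]) auto
qed

section \<open>The statistics under the decomposition\<close>

lemma finite_DES [simp]: "finite (DES xs)"
  by (simp add: DES_def)

lemma DES_subset: "DES xs \<subseteq> {1..<length xs}"
  by (auto simp: DES_def)

lemma DES_glue:
  assumes A: "set A = {1..length A}" and B: "set B = {1..length B}"
  shows "DES (glue A B) =
    DES A \<union> ({length A} - {0}) \<union> (\<lambda>i. i + Suc (length A)) ` DES B"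
proof (rule set_eqI)
  fix i
  let ?m = "length A"
  have shift: "i \<in> (\<lambda>i. i + Suc ?m) ` S \<longleftrightarrow> Suc ?m \<le> i \<and> i - Suc ?m \<in> S" for S
    by (force simp: image_iff)
  have sub: "DES A \<subseteq> {1..<?m}" "DES B \<subseteq> {1..<length B}" by (rule DES_subset)+
  consider "i = 0" | "0 < i" "i < ?m" | "0 < i" "i = ?m" | "i = Suc ?m" | "Suc ?m < i" by linarith
  then show "i \<in> DES (glue A B) \<longleftrightarrow> i \<in> DES A \<union> ({?m} - {0}) \<union> (\<lambda>i. i + Suc ?m) ` DES B"
  proof cases
    case 1
    then show ?thesis unfolding Un_iff shift by (auto simp: DES_def)
  next
    case 2
    then show ?thesis unfolding Un_iff shift by (auto simp: DES_def glue_nth_left)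
  next
    case 3
    have "A ! (i - 1) \<in> set A" using 3 by (intro nth_mem) auto
    then have "1 < glue A B ! (i - 1)" using 3 A by (simp add: glue_nth_left)
    then show ?thesis using 3 unfolding Un_iff shift
      by (auto simp: DES_def glue_nth_mid Suc_le_eq)
  next
    case 4
    have "glue A B ! Suc ?m \<noteq> 0" if "B \<noteq> []"
      using that glue_nth_right[of 0 B A] by simp
    then show ?thesis using 4 sub(1) unfolding Un_iff shift
      by (auto simp: DES_def glue_nth_mid glue_nth_right')
  next
    case 5
    then have "i \<notin> DES A" using sub by auto
    then show ?thesis using 5 unfolding Un_iff shift
      by (auto simp: DES_def glue_nth_right' Suc_diff_Suc)
  qed
qed

lemma des_glue:
  assumes A: "set A = {1..length A}" and B: "set B = {1..length B}"
  shows "des (glue A B) = des A + (if A = [] then 0 else 1) + des B"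
proof -
  let ?s = "\<lambda>i. i + Suc (length A)"
  have sub: "DES A \<subseteq> {1..<length A}" by (rule DES_subset)
  have "card (DES A \<union> ({length A} - {0}) \<union> ?s ` DES B)
      = card (DES A \<union> ({length A} - {0})) + card (?s ` DES B)"
    using sub by (intro card_Un_disjoint) auto
  also have "card (DES A \<union> ({length A} - {0})) = card (DES A) + card ({length A} - {0})"
    using sub by (intro card_Un_disjoint) auto
  also have "card ({length A} - {0}) = (if A = [] then 0 else 1)"
    by simp
  also have "card (?s ` DES B) = card (DES B)"
    by (rule card_image) (simp add: inj_on_def)
  finally show ?thesis
    by (simp add: des_def DES_glue[OF A B])
qed

text \<open>For nonempty \<open>A\<close> the descent from \<open>A\<close> to the 1 sits at position \<open>length A\<close>, which is the
  very value that the definition of \<open>iar A\<close> adjoins to the descents of \<open>A\<close>.\<close>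

lemma iar_glue:
  assumes A: "set A = {1..length A}" and B: "set B = {1..length B}"
  shows "iar (glue A B) = (if A = [] then Suc (iar B) else iar A)"
proof (cases "A = []")
  case True
  have "DES (glue A B) \<union> {length (glue A B)} = Suc ` (DES B \<union> {length B})"
    unfolding DES_glue[OF A B] using True by (simp add: DES_def[of "[]"])
  then have "iar (glue A B) = Min (Suc ` (DES B \<union> {length B}))"
    by (simp add: iar_def)
  also have "\<dots> = Suc (iar B)"
    unfolding iar_def by (rule mono_Min_commute[symmetric]) (auto simp: mono_def)
  finally show ?thesis using True by simp
next
  case False
  define S where "S = DES A \<union> {length A}"
  define T where "T = (\<lambda>i. i + Suc (length A)) ` DES B \<union> {length (glue A B)}"
  have "DES (glue A B) \<union> {length (glue A B)} = S \<union> T"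
    using False by (auto simp: DES_glue[OF A B] S_def T_def)
  then have "iar (glue A B) = Min (S \<union> T)" by (simp only: iar_def)
  also have "\<dots> = min (Min S) (Min T)"
    by (rule Min_Un) (auto simp: S_def T_def)
  also have "Min S \<le> length A" by (rule Min_le) (auto simp: S_def)
  moreover have "length A \<le> Min T" by (subst Min_ge_iff) (auto simp: T_def)
  ultimately have "iar (glue A B) = Min S" by simp
  then show ?thesis using False by (simp add: S_def iar_def)
qed

text \<open>No proper prefix of the block \<open>A\<^sup>+ 1\<close> is a union of components, since it misses the 1
  and therefore consists of entries greater than 1.\<close>

lemma ncomp_glue:
  assumes A: "set A = {1..length A}" and B: "set B = {1..length B}"
  shows "ncomp (glue A B) = Suc (ncomp B)"
proof -
  define C where "C xs = {i \<in> {1..length xs}. \<forall>j\<in>{1..i}. entry xs j \<le> i}" for xs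
  let ?m = "length A"
  let ?g = "glue A B"
  have small: "?g ! l \<le> Suc ?m" if "l \<le> ?m" for l
    using that A nth_mem[of l A]
    by (cases "l = ?m") (auto simp: glue_nth_mid glue_nth_left)
  have "C ?g = insert (Suc ?m) ((\<lambda>i. i + Suc ?m) ` C B)"
  proof (rule set_eqI)
    fix i
    consider "i = 0" | "1 \<le> i" "i \<le> ?m" | "i = Suc ?m" | "Suc ?m < i" by linarith
    then show "i \<in> C ?g \<longleftrightarrow> i \<in> insert (Suc ?m) ((\<lambda>i. i + Suc ?m) ` C B)"
    proof cases
      case 1
      then show ?thesis by (auto simp: C_def)
    next
      case 2
      have "\<not> (\<forall>j\<in>{1..i}. entry ?g j \<le> i)"
      proof
        assume *: "\<forall>j\<in>{1..i}. entry ?g j \<le> i"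
        \<comment> \<open>The first \<open>i\<close> entries of \<open>A\<close> would be \<open>i\<close> distinct elements of \<open>{1..<i}\<close>.\<close>
        have dist: "distinct A" using A by (intro card_distinct) simp
        have sub: "set (take i A) \<subseteq> {1..<i}"
        proof
          fix x assume x: "x \<in> set (take i A)"
          then obtain j where j: "j < i" "x = A ! j" using 2 by (auto simp: in_set_conv_nth)
          then have "entry ?g (Suc j) \<le> i" using bspec[OF *, of "Suc j"] by simp
          moreover have "x \<ge> 1" using x A set_take_subset[of i A] by auto
          ultimately show "x \<in> {1..<i}" using j 2 by (simp add: glue_nth_left)
        qed
        have "card (set (take i A)) = i" using 2 dist by (simp add: distinct_card)
        moreover have "card (set (take i A)) \<le> i - 1" using card_mono[OF _ sub] by simp
        ultimately show False using 2 by simp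
      qed
      then show ?thesis using 2 by (auto simp: C_def)
    next
      case 3
      then show ?thesis using small by (auto simp: C_def)
    next
      case 4
      have "(\<forall>j\<in>{1..i}. entry ?g j \<le> i) \<longleftrightarrow> (\<forall>j\<in>{1..i - Suc ?m}. entry B j \<le> i - Suc ?m)"
        if i: "i \<le> ?m + length B + 1"
      proof
        assume *: "\<forall>j\<in>{1..i}. entry ?g j \<le> i"
        show "\<forall>j\<in>{1..i - Suc ?m}. entry B j \<le> i - Suc ?m"
        proof
          fix j assume j: "j \<in> {1..i - Suc ?m}"
          then obtain l where l: "j = Suc l" by (cases j) auto
          have "entry ?g (Suc ?m + j) \<le> i" using bspec[OF *, of "Suc ?m + j"] j 4 by auto
          then show "entry B j \<le> i - Suc ?m"
            using glue_nth_right[of l B A] j i l by simp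
        qed
      next
        assume *: "\<forall>j\<in>{1..i - Suc ?m}. entry B j \<le> i - Suc ?m"
        show "\<forall>j\<in>{1..i}. entry ?g j \<le> i"
        proof
          fix j assume j: "j \<in> {1..i}"
          show "entry ?g j \<le> i"
          proof (cases "j \<le> Suc ?m")
            case True
            then have "j - 1 \<le> ?m" by linarith
            then have "entry ?g j \<le> Suc ?m" by (rule small)
            then show ?thesis using 4 by linarith
          next
            case False
            then have "j - Suc ?m \<in> {1..i - Suc ?m}" using j by auto
            then have "entry B (j - Suc ?m) \<le> i - Suc ?m" by (rule bspec[OF *])
            then show ?thesis using False j i 4 by (simp add: glue_nth_right')
          qed
        qed
      qed
      moreover have "i \<in> (\<lambda>i. i + Suc ?m) ` S \<longleftrightarrow> i - Suc ?m \<in> S" for S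
        using 4 by (force simp: image_iff)
      ultimately show ?thesis using 4 by (auto simp: C_def)
    qed
  qed
  moreover have "Suc ?m \<notin> (\<lambda>i. i + Suc ?m) ` C B" by (auto simp: C_def)
  moreover have "finite (C B)" by (simp add: C_def)
  moreover have "card ((\<lambda>i. i + Suc ?m) ` C B) = card (C B)"
    by (rule card_image) (simp add: inj_on_def)
  ultimately have "card (C ?g) = Suc (card (C B))" by simp
  then show ?thesis by (simp add: ncomp_def C_def)
qed

section \<open>The functional equation\<close>

definition weight :: "'a \<Rightarrow> 'a \<Rightarrow> 'a \<Rightarrow> nat list \<Rightarrow> 'a :: comm_ring_1" where
  "weight t r p xs = t ^ des xs * r ^ iar xs * p ^ ncomp xs"

lemma gf_nth: "fps_nth (gf P t r p) n = (\<Sum>xs\<in>avoiders P n. weight t r p xs)"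
  by (simp add: gf_def weight_def)

lemma weight_Nil [simp]: "weight t r p [] = 1"
  by (simp add: weight_def des_def iar_def ncomp_def DES_def)

lemma gf_312_nth_0: "fps_nth (gf {pat312} t r p) 0 = (1 :: 'a :: comm_ring_1)"
  by (simp add: gf_nth avoiders_312_0)

lemma weight_glue:
  assumes "A \<in> avoiders {pat312} k" "B \<in> avoiders {pat312} l"
  shows "weight t r p (glue A B) =
    (if k = 0 then p * (r * weight t r p B) else p * (t * (weight t r 1 A * weight t 1 p B)))"
proof -
  have len: "length A = k" "length B = l" using assms by (simp_all add: length_avoider_312)
  have sets: "set A = {1..length A}" "set B = {1..length B}"
    using assms len by (auto simp: avoiders_312_iff)
  have Nil: "des [] = 0" by (simp add: des_def DES_def)
  show ?thesis
    using len(1) unfolding weight_def des_glue[OF sets] iar_glue[OF sets] ncomp_glue[OF sets]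
    by (cases "A = []") (auto simp: power_add Nil mult_ac)
qed

lemma gf_312_eq:
  fixes t r p :: "'a :: comm_ring_1"
  shows "gf {pat312} t r p =
    1 + fps_X * (fps_const p * (fps_const r * gf {pat312} t r p +
      fps_const t * ((gf {pat312} t r 1 - 1) * gf {pat312} t 1 p)))"
    (is "?F = 1 + fps_X * ?R")
proof (rule fps_ext)
  fix m
  let ?S = "avoiders {pat312}"
  show "fps_nth ?F m = fps_nth (1 + fps_X * ?R) m"
  proof (cases m)
    case 0
    then show ?thesis by (simp add: gf_312_nth_0)
  next
    case (Suc n)
    define f where "f k = (\<Sum>(A, B)\<in>?S k \<times> ?S (n - k). weight t r p (glue A B))" for k
    have f0: "f 0 = p * (r * fps_nth ?F n)"
    proof -
      have "f 0 = (\<Sum>A\<in>?S 0. \<Sum>B\<in>?S n. weight t r p (glue A B))"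
        by (simp add: f_def sum.cartesian_product)
      also have "\<dots> = (\<Sum>B\<in>?S n. weight t r p (glue [] B))"
        by (simp add: avoiders_312_0)
      also have "\<dots> = (\<Sum>B\<in>?S n. p * (r * weight t r p B))"
        by (intro sum.cong refl, subst weight_glue[of _ 0 _ n]) (auto simp: avoiders_312_0)
      finally show ?thesis by (simp add: gf_nth sum_distrib_left)
    qed
    have fk: "f k = p * (t * (fps_nth (gf {pat312} t r 1 - 1) k
        * fps_nth (gf {pat312} t 1 p) (n - k)))" if "k \<noteq> 0" for k
    proof -
      have "f k = (\<Sum>A\<in>?S k. \<Sum>B\<in>?S (n - k). weight t r p (glue A B))"
        by (simp add: f_def sum.cartesian_product)
      also have "\<dots> = (\<Sum>A\<in>?S k. \<Sum>B\<in>?S (n - k). p * (t * (weight t r 1 A * weight t 1 p B)))"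
        using that by (intro sum.cong refl, subst weight_glue[of _ k _ "n - k"]) auto
      also have "\<dots> = p * (t * ((\<Sum>A\<in>?S k. weight t r 1 A) * (\<Sum>B\<in>?S (n - k). weight t 1 p B)))"
        unfolding sum_product by (simp add: sum_distrib_left)
      finally show ?thesis using that by (simp add: gf_nth)
    qed
    have "fps_nth ?F m = (\<Sum>xs\<in>?S (Suc n). weight t r p xs)"
      by (simp add: Suc gf_nth)
    also have "\<dots> = (\<Sum>x\<in>(SIGMA k:{..n}. ?S k \<times> ?S (n - k)).
        weight t r p (case x of (k, A, B) \<Rightarrow> glue A B))"
      by (rule sum.reindex_bij_betw[OF avoiders_312_Suc, symmetric])
    also have "\<dots> = (\<Sum>(k, y)\<in>(SIGMA k:{..n}. ?S k \<times> ?S (n - k)).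
        (case y of (A, B) \<Rightarrow> weight t r p (glue A B)))"
      by (intro sum.cong refl) auto
    also have "\<dots> = (\<Sum>k\<le>n. f k)"
      unfolding f_def by (rule sum.Sigma[symmetric]) (auto intro: finite_avoiders)
    also have "\<dots> = f 0 + (\<Sum>k\<in>{..n} - {0}. f k)"
      by (rule sum.remove) auto
    also have "(\<Sum>k\<in>{..n} - {0}. f k) = (\<Sum>k\<in>{..n} - {0}. p * (t *
        (fps_nth (gf {pat312} t r 1 - 1) k * fps_nth (gf {pat312} t 1 p) (n - k))))"
      by (intro sum.cong refl fk) auto
    also have "\<dots> = (\<Sum>k\<in>{0..n}. p * (t *
        (fps_nth (gf {pat312} t r 1 - 1) k * fps_nth (gf {pat312} t 1 p) (n - k))))"
      by (rule sum.mono_neutral_left) (auto simp: gf_312_nth_0)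
    also have "\<dots> = p * (t * fps_nth ((gf {pat312} t r 1 - 1) * gf {pat312} t 1 p) n)"
      by (simp only: fps_mult_nth sum_distrib_left)
    finally show ?thesis
      by (simp add: Suc f0 distrib_left)
  qed
qed

section \<open>Solving the functional equation\<close>

lemma narayana_gf_eq_gf_312:
  fixes t :: "'a :: field_char_0"
  assumes "t \<noteq> 0"
  shows "narayana_gf t = gf {pat312} t 1 1"
proof -
  define N where "N = gf {pat312} t 1 1"
  define T where "T = fps_const t"
  define Z where "Z = (fps_X :: 'a fps)"
  define D where "D = 1 - 2 * (T + 1) * Z + (T - 1)\<^sup>2 * Z\<^sup>2"
  define Q where "Q = 1 + (T - 1) * Z - 2 * T * Z * N"
  have "N = 1 + Z * (N + T * ((N - 1) * N))"
    using gf_312_eq[of t 1 1] by (simp add: N_def T_def Z_def)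
  \<comment> \<open>Complete the square in the quadratic equation for \<open>N\<close>.\<close>
  then have "Q\<^sup>2 = D"
    unfolding Q_def D_def by algebra
  moreover have "fps_sqrt D ^ 2 = D"
    by (rule fps_sqrt_power2) (simp add: D_def Z_def)
  ultimately have "fps_sqrt D = Q \<or> fps_sqrt D = - Q"
    by (metis power2_eq_iff)
  moreover have "fps_nth (fps_sqrt D) 0 = 1" "fps_nth Q 0 = 1"
    by (simp_all add: fps_sqrt_nth_0 Q_def Z_def)
  ultimately have sqrt: "fps_sqrt D = Q" by auto
  have nz: "2 * T * Z \<noteq> 0" using assms by (simp add: T_def Z_def)
  have "narayana_gf t = (1 + (T - 1) * Z - fps_sqrt D) / (2 * T * Z)"
    by (simp add: narayana_gf_def Let_def T_def Z_def D_def)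
  also have "\<dots> = (2 * T * Z * N) / (2 * T * Z)"
    by (simp add: sqrt Q_def)
  also have "\<dots> = N" using nz by (rule nonzero_mult_div_cancel_left)
  finally show ?thesis by (simp add: N_def)
qed

lemma gf_tilde_312:
  fixes t r p :: "'a :: field_char_0"
  assumes "t \<noteq> 0" "r \<noteq> 0" "p \<noteq> 0"
  defines "T \<equiv> fps_const t" and "R \<equiv> fps_const r" and "P \<equiv> fps_const p" and "N \<equiv> narayana_gf t"
  shows "gf_tilde {pat312} t r p =
    (1 - (R + P + T * N) * fps_X + (R * P + (R + P - 1) * T * N) * fps_X\<^sup>2) /
    ((1 - R * P * fps_X) * (1 - R * fps_X - T * N * fps_X) * (1 - P * fps_X - T * N * fps_X))"
proof -
  define Z where "Z = (fps_X :: 'a fps)"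
  define F where "F = gf {pat312} t r p"
  define FR where "FR = gf {pat312} t r 1"
  define FP where "FP = gf {pat312} t 1 p"
  define num where "num = 1 - (R + P + T * N) * Z + (R * P + (R + P - 1) * T * N) * Z\<^sup>2"
  define D0 where "D0 = 1 - R * P * Z"
  define D1 where "D1 = 1 - R * Z - T * N * Z"
  define D2 where "D2 = 1 - P * Z - T * N * Z"
  have N: "N = gf {pat312} t 1 1"
    unfolding N_def by (rule narayana_gf_eq_gf_312) fact
  have eqN: "N = 1 + Z * (N + T * ((N - 1) * N))"
    using gf_312_eq[of t 1 1] by (simp add: N Z_def T_def)
  have eqF: "F = 1 + Z * (P * (R * F + T * ((FR - 1) * FP)))"
    unfolding F_def FR_def FP_def Z_def P_def R_def T_def by (rule gf_312_eq)
  have eqR: "FR = 1 + Z * (R * FR + T * ((FR - 1) * N))"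
    using gf_312_eq[of t r 1] by (simp add: N FR_def Z_def R_def T_def)
  have eqP: "FP = 1 + Z * (P * (FP + T * ((N - 1) * FP)))"
    using gf_312_eq[of t 1 p] by (simp add: N FP_def Z_def P_def T_def)
  have 0: "D0 * (F - 1) = R * P * Z + Z * P * T * ((FR - 1) * FP)"
    using eqF unfolding D0_def by algebra
  \<comment> \<open>The linear equation for \<open>p = 1\<close>, solved up to division by \<open>D1\<close>.\<close>
  have 1: "D1 * (FR - 1) = R * Z"
    using eqR unfolding D1_def by algebra
  \<comment> \<open>The linear equation for \<open>r = 1\<close> brings in the factor \<open>1 + T * (N - 1)\<close>. By the quadratic
    equation for \<open>N\<close> it is the inverse of \<open>1 - T * Z * N\<close>.\<close>
  have 2: "D2 * FP = 1 - T * Z * N"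
  proof -
    have U: "(1 + T * (N - 1)) * (1 - T * Z * N) = 1"
      using eqN by algebra
    have V: "(1 - P * Z * (1 + T * (N - 1))) * FP = 1"
      using eqP by algebra
    have "D2 = (1 - T * Z * N) * (1 - P * Z * (1 + T * (N - 1)))"
      using U unfolding D2_def by algebra
    then show ?thesis using V by algebra
  qed
  have 3: "D1 * D2 + T * Z * (1 - T * Z * N) = num"
    using eqN unfolding num_def D1_def D2_def by algebra
  have "D0 * D1 * D2 * (F - 1) = D1 * D2 * (R * P * Z + Z * P * T * ((FR - 1) * FP))"
    unfolding 0[symmetric] by (simp only: mult_ac)
  also have "\<dots> = R * P * Z * (D1 * D2) + Z * P * T * ((D1 * (FR - 1)) * (D2 * FP))"
    by algebra
  also have "\<dots> = R * P * Z * num"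
    unfolding 1 2 3[symmetric] by algebra
  finally have main: "D0 * D1 * D2 * (F - 1) = R * P * Z * num" .
  have D_0: "fps_nth (D0 * D1 * D2) 0 = 1"
    by (simp add: D0_def D1_def D2_def Z_def)
  then have inv: "D0 * D1 * D2 * inverse (D0 * D1 * D2) = 1"
    by (intro inverse_mult_eq_1') simp
  have "F - 1 = (D0 * D1 * D2 * (F - 1)) * inverse (D0 * D1 * D2)"
    using inv by algebra
  also have "\<dots> = (R * P * Z) * (num * inverse (D0 * D1 * D2))"
    unfolding main by (simp only: mult.assoc)
  finally have F: "F - 1 = (R * P * Z) * (num * inverse (D0 * D1 * D2))" .
  have nz: "R * P * Z \<noteq> 0" using assms(2,3) by (simp add: R_def P_def Z_def)
  have "gf_tilde {pat312} t r p = (F - 1) / (R * P * Z)"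
    by (simp add: gf_tilde_def F_def R_def P_def Z_def)
  also have "\<dots> = num * inverse (D0 * D1 * D2)"
    unfolding F using nz by (rule nonzero_mult_div_cancel_left)
  also have "\<dots> = num / (D0 * D1 * D2)"
    using D_0 by (intro fps_divide_unit[symmetric]) simp
  finally show ?thesis
    unfolding num_def D0_def D1_def D2_def Z_def .
qed

theorem theorem3p9:
  shows "gf_tilde {[3, 1, 2]} var_t var_r var_p =
    (let t = fps_const var_t; r = fps_const var_r; p = fps_const var_p; z = fps_X;
         N = narayana_gf var_t
     in (1 - (r + p + t * N) * z + (r * p + (r + p - 1) * t * N) * z\<^sup>2) /
        ((1 - r * p * z) * (1 - r * z - t * N * z) * (1 - p * z - t * N * z)))"
proof -
  have "var_t \<noteq> 0" "var_r \<noteq> 0" "var_p \<noteq> 0"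
    by (simp_all add: var_t_def var_r_def var_p_def)
  then show ?thesis
    unfolding Let_def pat312_def[symmetric] by (rule gf_tilde_312)
qed

end
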